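(* Let $X_n$ be a finite Dynkin diagram (one of $A_n,B_n,C_n,D_n,E_6,E_7,E_8,F_4,G_2$) with poset of positive roots $(\Phi_+,\le)$. The set $(u_p)_p$, where $p$ runs over all antichains of $(\Phi_+,\le)$, is a basis (over $\mathbb{Z}$) of the ring $U_{X_n}$.
   Context: $\Phi_+$ is the set of positive roots of the (irreducible, reduced, crystallographic) root system of type $X_n$, with the partial order $\alpha\le\beta$ iff $\beta-\alpha$ has non-negative coefficients in the basis of simple roots. An antichain is a (possibly empty) set of pairwise incomparable elements of $\Phi_+$. $U_{X_n}$ is the commutative unital ring (over $\mathbb{Z}$) generated by variables $u_\alpha$, $\alpha\in\Phi_+$, modulo the relations $u_\alpha u_\beta=u_{\min(\alpha,\beta)}$ for all $\alpha,\beta\in\Phi_+$ that are comparable for $\le$ (including $\alpha=\beta$, i.e. $u_\alpha^2=u_\alpha$). For an antichain $p=\{\alpha_1,\dots,\alpha_k\}$, $u_p=u_{\alpha_1}\cdots u_{\alpha_k}\in U_{X_n}$ (with $u_\emptyset=1$). *)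

theory Defs
  imports "HOL-Analysis.Analysis" "HOL-Algebra.QuotRing" "HOL-Library.Poly_Mapping"
begin

section \<open>Root systems and Dynkin types\<close>

definition root_reflection :: "'a::euclidean_space \<Rightarrow> 'a \<Rightarrow> 'a" where
  "root_reflection \<alpha> x = x - (2 * (x \<bullet> \<alpha>) / (\<alpha> \<bullet> \<alpha>)) *\<^sub>R \<alpha>"

definition root_system :: "'a::euclidean_space set \<Rightarrow> bool" where
  "root_system \<Phi> \<longleftrightarrow>
     finite \<Phi> \<and> 0 \<notin> \<Phi> \<and> span \<Phi> = UNIV \<and> (\<forall>\<alpha>\<in>\<Phi>. root_reflection \<alpha> ` \<Phi> = \<Phi>)"

definition crystallographic :: "'a::euclidean_space set \<Rightarrow> bool" where
  "crystallographic \<Phi> \<longleftrightarrow> (\<forall>\<alpha>\<in>\<Phi>. \<forall>\<beta>\<in>\<Phi>. 2 * (\<beta> \<bullet> \<alpha>) / (\<alpha> \<bullet> \<alpha>) \<in> \<int>)"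

definition reduced_roots :: "'a::euclidean_space set \<Rightarrow> bool" where
  "reduced_roots \<Phi> \<longleftrightarrow> (\<forall>\<alpha>\<in>\<Phi>. \<forall>c. c *\<^sub>R \<alpha> \<in> \<Phi> \<longrightarrow> c = 1 \<or> c = -1)"

definition irreducible_roots :: "'a::euclidean_space set \<Rightarrow> bool" where
  "irreducible_roots \<Phi> \<longleftrightarrow>
     \<Phi> \<noteq> {} \<and>
     \<not> (\<exists>\<Phi>1 \<Phi>2. \<Phi>1 \<noteq> {} \<and> \<Phi>2 \<noteq> {} \<and> \<Phi>1 \<union> \<Phi>2 = \<Phi> \<and> (\<forall>\<alpha>\<in>\<Phi>1. \<forall>\<beta>\<in>\<Phi>2. \<alpha> \<bullet> \<beta> = 0))"

definition simple_roots :: "'a::euclidean_space set \<Rightarrow> 'a set \<Rightarrow> bool" where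
  "simple_roots \<Phi> \<Delta> \<longleftrightarrow>
     \<Delta> \<subseteq> \<Phi> \<and> independent \<Delta> \<and> span \<Delta> = UNIV \<and>
     (\<forall>\<alpha>\<in>\<Phi>. (\<forall>\<delta>\<in>\<Delta>. representation \<Delta> \<alpha> \<delta> \<in> \<int>) \<and>
            ((\<forall>\<delta>\<in>\<Delta>. 0 \<le> representation \<Delta> \<alpha> \<delta>) \<or> (\<forall>\<delta>\<in>\<Delta>. representation \<Delta> \<alpha> \<delta> \<le> 0)))"

definition positive_roots :: "'a::euclidean_space set \<Rightarrow> 'a set \<Rightarrow> 'a set" where
  "positive_roots \<Phi> \<Delta> = {\<alpha>\<in>\<Phi>. \<forall>\<delta>\<in>\<Delta>. 0 \<le> representation \<Delta> \<alpha> \<delta>}"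

definition root_le :: "'a::euclidean_space set \<Rightarrow> 'a \<Rightarrow> 'a \<Rightarrow> bool" where
  "root_le \<Delta> \<alpha> \<beta> \<longleftrightarrow> (\<forall>\<delta>\<in>\<Delta>. 0 \<le> representation \<Delta> (\<beta> - \<alpha>) \<delta>)"

datatype dynkin =
  Dynkin_A nat | Dynkin_B nat | Dynkin_C nat | Dynkin_D nat
  | Dynkin_E6 | Dynkin_E7 | Dynkin_E8 | Dynkin_F4 | Dynkin_G2

fun dynkin_rank :: "dynkin \<Rightarrow> nat" where
  "dynkin_rank (Dynkin_A n) = n"
| "dynkin_rank (Dynkin_B n) = n"
| "dynkin_rank (Dynkin_C n) = n"
| "dynkin_rank (Dynkin_D n) = n"
| "dynkin_rank Dynkin_E6 = 6"
| "dynkin_rank Dynkin_E7 = 7"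
| "dynkin_rank Dynkin_E8 = 8"
| "dynkin_rank Dynkin_F4 = 4"
| "dynkin_rank Dynkin_G2 = 2"

text \<open>\<open>C\<^sub>2 = B\<^sub>2\<close> is allowed under both names; \<open>D\<^sub>3 = A\<^sub>3\<close> only under the latter.\<close>

fun valid_dynkin :: "dynkin \<Rightarrow> bool" where
  "valid_dynkin (Dynkin_A n) \<longleftrightarrow> 1 \<le> n"
| "valid_dynkin (Dynkin_B n) \<longleftrightarrow> 2 \<le> n"
| "valid_dynkin (Dynkin_C n) \<longleftrightarrow> 2 \<le> n"
| "valid_dynkin (Dynkin_D n) \<longleftrightarrow> 4 \<le> n"
| "valid_dynkin _ \<longleftrightarrow> True"

text \<open>
  Vertices are numbered as in Bourbaki's tables, but from \<open>0\<close>. The diagram is given by its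
  edges; \<open>dynkin_double X i j\<close> and \<open>dynkin_triple X i j\<close> single out the multiple edge,
  oriented from the long root \<open>i\<close> to the short root \<open>j\<close>.
\<close>

definition path_edge :: "nat \<Rightarrow> nat \<Rightarrow> bool" where
  "path_edge i j \<longleftrightarrow> j = Suc i \<or> i = Suc j"

definition E_edge :: "nat \<Rightarrow> nat \<Rightarrow> bool" where
  "E_edge i j \<longleftrightarrow> {i, j} \<in> {{0, 2}, {1, 3}, {2, 3}, {3, 4}, {4, 5}, {5, 6}, {6, 7}}"

fun dynkin_edge :: "dynkin \<Rightarrow> nat \<Rightarrow> nat \<Rightarrow> bool" where
  "dynkin_edge (Dynkin_D n) i j \<longleftrightarrow>
     (i < n - 1 \<and> j < n - 1 \<and> path_edge i j) \<or> {i, j} = {n - 3, n - 1}"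
| "dynkin_edge Dynkin_E6 i j \<longleftrightarrow> E_edge i j"
| "dynkin_edge Dynkin_E7 i j \<longleftrightarrow> E_edge i j"
| "dynkin_edge Dynkin_E8 i j \<longleftrightarrow> E_edge i j"
| "dynkin_edge _ i j \<longleftrightarrow> path_edge i j"

fun dynkin_double :: "dynkin \<Rightarrow> nat \<Rightarrow> nat \<Rightarrow> bool" where
  "dynkin_double (Dynkin_B n) i j \<longleftrightarrow> i = n - 2 \<and> j = n - 1"
| "dynkin_double (Dynkin_C n) i j \<longleftrightarrow> i = n - 1 \<and> j = n - 2"
| "dynkin_double Dynkin_F4 i j \<longleftrightarrow> i = 1 \<and> j = 2"
| "dynkin_double _ i j \<longleftrightarrow> False"

fun dynkin_triple :: "dynkin \<Rightarrow> nat \<Rightarrow> nat \<Rightarrow> bool" where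
  "dynkin_triple Dynkin_G2 i j \<longleftrightarrow> i = 1 \<and> j = 0"
| "dynkin_triple _ i j \<longleftrightarrow> False"

text \<open>The entry at \<open>(i, j)\<close> is \<open>\<langle>\<alpha>\<^sub>i, \<alpha>\<^sub>j\<^sup>\<or>\<rangle> = 2 (\<alpha>\<^sub>i, \<alpha>\<^sub>j) / (\<alpha>\<^sub>j, \<alpha>\<^sub>j)\<close>.\<close>

definition cartan_matrix :: "dynkin \<Rightarrow> nat \<Rightarrow> nat \<Rightarrow> int" where
  "cartan_matrix X i j =
     (if i = j then 2
      else if dynkin_triple X i j then -3
      else if dynkin_double X i j then -2
      else if dynkin_edge X i j then -1
      else 0)"

definition of_dynkin_type :: "'a::euclidean_space set \<Rightarrow> dynkin \<Rightarrow> bool" where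
  "of_dynkin_type \<Delta> X \<longleftrightarrow>
     (\<exists>a. bij_betw a {..<dynkin_rank X} \<Delta> \<and>
        (\<forall>i<dynkin_rank X. \<forall>j<dynkin_rank X.
           2 * (a i \<bullet> a j) / (a j \<bullet> a j) = real_of_int (cartan_matrix X i j)))"


section \<open>The ring attached to a poset\<close>

text \<open>
  The polynomial ring over the integers in commuting variables indexed by \<open>V\<close>: a monomial is
  its finitely supported exponent function, a polynomial a finitely supported function from
  monomials to coefficients, and the product of \<^typ>\<open>('a \<Rightarrow>\<^sub>0 nat) \<Rightarrow>\<^sub>0 int\<close> is convolution.
\<close>

definition int_poly_ring :: "'a set \<Rightarrow> (('a \<Rightarrow>\<^sub>0 nat) \<Rightarrow>\<^sub>0 int) ring" where
  "int_poly_ring V =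
     \<lparr>carrier = {p. \<forall>m\<in>Poly_Mapping.keys p. Poly_Mapping.keys m \<subseteq> V},
      mult = (*), one = 1, zero = 0, add = (+)\<rparr>"

definition poly_var :: "'a \<Rightarrow> ('a \<Rightarrow>\<^sub>0 nat) \<Rightarrow>\<^sub>0 int" where
  "poly_var \<alpha> = Poly_Mapping.single (Poly_Mapping.single \<alpha> 1) 1"

lemma int_poly_ring_cring: "cring (int_poly_ring V)"
proof -
  let ?R = "int_poly_ring V"
  have add: "p + q \<in> carrier ?R" if "p \<in> carrier ?R" "q \<in> carrier ?R" for p q
    using that Poly_Mapping.keys_add[of p q] unfolding int_poly_ring_def by auto
  have mult: "p * q \<in> carrier ?R" if p: "p \<in> carrier ?R" and q: "q \<in> carrier ?R" for p q
  proof -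
    have "Poly_Mapping.keys m \<subseteq> V" if m: "m \<in> Poly_Mapping.keys (p * q)" for m
    proof -
      obtain a b where ab: "m = a + b" "a \<in> Poly_Mapping.keys p" "b \<in> Poly_Mapping.keys q"
        using m Poly_Mapping.keys_mult[of p q] by blast
      have "Poly_Mapping.keys a \<subseteq> V" "Poly_Mapping.keys b \<subseteq> V"
        using p q ab by (simp_all add: int_poly_ring_def)
      then show ?thesis
        using Poly_Mapping.keys_add[of a b] ab(1) by blast
    qed
    then show ?thesis by (simp add: int_poly_ring_def)
  qed
  have uminus: "- p \<in> carrier ?R" if "p \<in> carrier ?R" for p
    using that by (simp add: int_poly_ring_def)
  have ops: "x \<oplus>\<^bsub>?R\<^esub> y = x + y" "x \<otimes>\<^bsub>?R\<^esub> y = x * y" "\<zero>\<^bsub>?R\<^esub> = 0" "\<one>\<^bsub>?R\<^esub> = 1" for x y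
    by (simp_all add: int_poly_ring_def)
  have units: "0 \<in> carrier ?R" "1 \<in> carrier ?R"
    by (simp_all add: int_poly_ring_def)
  have "abelian_group ?R"
  proof (rule abelian_groupI, unfold ops)
    show "\<exists>q\<in>carrier ?R. q + p = 0" if "p \<in> carrier ?R" for p
      by (rule bexI[of _ "- p"]) (simp_all add: uminus that)
  qed (simp_all add: add units ac_simps)
  moreover have "comm_monoid ?R"
    by (rule comm_monoidI; unfold ops) (simp_all add: mult units ac_simps)
  ultimately show ?thesis
    by (rule cringI) (simp add: ops distrib_right)
qed

lemma poly_var_in_carrier: "\<alpha> \<in> V \<Longrightarrow> poly_var \<alpha> \<in> carrier (int_poly_ring V)"
  by (simp add: int_poly_ring_def poly_var_def)

definition poset_min :: "('a \<Rightarrow> 'a \<Rightarrow> bool) \<Rightarrow> 'a \<Rightarrow> 'a \<Rightarrow> 'a" where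
  "poset_min leq \<alpha> \<beta> = (if leq \<alpha> \<beta> then \<alpha> else \<beta>)"

definition U_relations :: "'a set \<Rightarrow> ('a \<Rightarrow> 'a \<Rightarrow> bool) \<Rightarrow> (('a \<Rightarrow>\<^sub>0 nat) \<Rightarrow>\<^sub>0 int) set" where
  "U_relations P leq =
     {poly_var \<alpha> * poly_var \<beta> - poly_var (poset_min leq \<alpha> \<beta>) | \<alpha> \<beta>.
        \<alpha> \<in> P \<and> \<beta> \<in> P \<and> (leq \<alpha> \<beta> \<or> leq \<beta> \<alpha>)}"

definition U_ideal :: "'a set \<Rightarrow> ('a \<Rightarrow> 'a \<Rightarrow> bool) \<Rightarrow> (('a \<Rightarrow>\<^sub>0 nat) \<Rightarrow>\<^sub>0 int) set" where
  "U_ideal P leq = genideal (int_poly_ring P) (U_relations P leq)"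

definition U_ring :: "'a set \<Rightarrow> ('a \<Rightarrow> 'a \<Rightarrow> bool) \<Rightarrow> (('a \<Rightarrow>\<^sub>0 nat) \<Rightarrow>\<^sub>0 int) set ring" where
  "U_ring P leq = int_poly_ring P Quot U_ideal P leq"

definition U_gen :: "'a set \<Rightarrow> ('a \<Rightarrow> 'a \<Rightarrow> bool) \<Rightarrow> 'a \<Rightarrow> (('a \<Rightarrow>\<^sub>0 nat) \<Rightarrow>\<^sub>0 int) set" where
  "U_gen P leq \<alpha> = U_ideal P leq +>\<^bsub>int_poly_ring P\<^esub> poly_var \<alpha>"

definition antichains :: "'a set \<Rightarrow> ('a \<Rightarrow> 'a \<Rightarrow> bool) \<Rightarrow> 'a set set" where
  "antichains P leq = {p. p \<subseteq> P \<and> (\<forall>\<alpha>\<in>p. \<forall>\<beta>\<in>p. \<alpha> \<noteq> \<beta> \<longrightarrow> \<not> leq \<alpha> \<beta> \<and> \<not> leq \<beta> \<alpha>)}"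

definition U_prod :: "'a set \<Rightarrow> ('a \<Rightarrow> 'a \<Rightarrow> bool) \<Rightarrow> 'a set \<Rightarrow> (('a \<Rightarrow>\<^sub>0 nat) \<Rightarrow>\<^sub>0 int) set" where
  "U_prod P leq p = (\<Otimes>\<^bsub>U_ring P leq\<^esub>\<alpha>\<in>p. U_gen P leq \<alpha>)"

text \<open>
  The family \<open>(b i)\<close>, \<open>i \<in> I\<close>, is a basis of the additive group of \<open>R\<close> as a module over the
  integers.
\<close>

definition Z_basis :: "('r, 'm) ring_scheme \<Rightarrow> 'i set \<Rightarrow> ('i \<Rightarrow> 'r) \<Rightarrow> bool" where
  "Z_basis R I b \<longleftrightarrow>
     b \<in> I \<rightarrow> carrier R \<and>
     (\<forall>x\<in>carrier R. \<exists>J c. finite J \<and> J \<subseteq> I \<and> x = (\<Oplus>\<^bsub>R\<^esub>i\<in>J. [(c i :: int)] \<cdot>\<^bsub>R\<^esub> b i)) \<and>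
     (\<forall>J c. finite J \<and> J \<subseteq> I \<and> (\<Oplus>\<^bsub>R\<^esub>i\<in>J. [(c i :: int)] \<cdot>\<^bsub>R\<^esub> b i) = \<zero>\<^bsub>R\<^esub> \<longrightarrow> (\<forall>i\<in>J. c i = 0))"

end

theory Submission
  imports Defs "HOL-Algebra.IntRing"
begin

text \<open>
  The statement holds for every finite poset. Multiplying \<open>u\<^sub>p\<close> by a generator \<open>u\<^sub>\<alpha>\<close> gives \<open>u\<^sub>p\<close>
  again if some element of \<open>p\<close> lies below \<open>\<alpha>\<close>, and otherwise gives the product over the
  antichain obtained from \<open>p\<close> by adding \<open>\<alpha>\<close> and deleting the elements above it; hence the \<open>u\<^sub>p\<close>
  span. Every upper set \<open>F\<close> defines a ring homomorphism to the integers sending \<open>u\<^sub>\<alpha>\<close> to \<open>1\<close> if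
  \<open>\<alpha> \<in> F\<close> and to \<open>0\<close> otherwise. An antichain is determined by its up-closure, so in a linear
  relation one may choose \<open>p\<close> with nonzero coefficient and minimal up-closure \<open>F\<close>; the
  homomorphism of \<open>F\<close> kills all other terms of the relation.
\<close>

section \<open>Polynomials over the integers\<close>

lemma int_poly_ring_simps [simp]:
  "x \<oplus>\<^bsub>int_poly_ring V\<^esub> y = x + y" "x \<otimes>\<^bsub>int_poly_ring V\<^esub> y = x * y"
  "\<zero>\<^bsub>int_poly_ring V\<^esub> = 0" "\<one>\<^bsub>int_poly_ring V\<^esub> = 1"
  by (simp_all add: int_poly_ring_def)

lemma int_poly_ring_minus_closed:
  assumes "x \<in> carrier (int_poly_ring V)" "y \<in> carrier (int_poly_ring V)"
  shows "x - y \<in> carrier (int_poly_ring V)"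
  using assms keys_diff[of x y] by (auto simp: int_poly_ring_def)

text \<open>The inverse of the ring record is a definite description over the carrier. It is
  identified with \<open>-\<close> by uniqueness of inverses, for elements of the carrier.\<close>

lemma int_poly_ring_a_inv:
  assumes "x \<in> carrier (int_poly_ring V)"
  shows "\<ominus>\<^bsub>int_poly_ring V\<^esub> x = - x"
proof -
  interpret R: cring "int_poly_ring V" by (rule int_poly_ring_cring)
  have "- x \<in> carrier (int_poly_ring V)"
    using int_poly_ring_minus_closed[OF R.zero_closed assms] by simp
  then show ?thesis
    using R.minus_equality[of "- x" x] assms by simp
qed

text \<open>For infinite \<open>A\<close> both products take the default value 1.\<close>

lemma int_poly_ring_finprod:
  assumes "f \<in> A \<rightarrow> carrier (int_poly_ring V)"
  shows "finprod (int_poly_ring V) f A = prod f A"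
proof -
  interpret R: cring "int_poly_ring V" by (rule int_poly_ring_cring)
  show ?thesis
    using assms by (induction A rule: infinite_finite_induct) (auto simp: Pi_def)
qed

lemma int_poly_ring_finsum:
  assumes "f \<in> A \<rightarrow> carrier (int_poly_ring V)"
  shows "finsum (int_poly_ring V) f A = sum f A"
proof -
  interpret R: cring "int_poly_ring V" by (rule int_poly_ring_cring)
  show ?thesis
    using assms by (induction A rule: infinite_finite_induct) (auto simp: Pi_def)
qed

lemma int_poly_ring_add_pow:
  assumes "x \<in> carrier (int_poly_ring V)"
  shows "[(k :: int)] \<cdot>\<^bsub>int_poly_ring V\<^esub> x = of_int k * x"
proof -
  interpret R: cring "int_poly_ring V" by (rule int_poly_ring_cring)
  have nat: "[n] \<cdot>\<^bsub>int_poly_ring V\<^esub> x = of_nat n * x" for n :: nat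
    by (induction n) (use assms in \<open>simp_all add: add_pow_def nat_pow_def algebra_simps\<close>)
  show ?thesis
  proof (cases "k \<ge> 0")
    case True
    then show ?thesis
      by (simp add: add_pow_int_ge nat)
  next
    case False
    have "of_nat (nat (- k)) * x \<in> carrier (int_poly_ring V)"
      using R.add.nat_pow_closed[OF assms, of "nat (- k)"] nat by simp
    then show ?thesis
      using False by (simp add: add_pow_int_lt nat int_poly_ring_a_inv)
  qed
qed

section \<open>Evaluation of polynomials at 0/1 points\<close>

text \<open>This is evaluation at the indicator function of \<open>F\<close>: a monomial has value 1
  there exactly when all its variables lie in \<open>F\<close>, whatever their exponents.\<close>

definition set_eval :: "'a set \<Rightarrow> (('a \<Rightarrow>\<^sub>0 nat) \<Rightarrow>\<^sub>0 int) \<Rightarrow> int" where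
  "set_eval F p = (\<Sum>m\<in>Poly_Mapping.keys p. Poly_Mapping.lookup p m * of_bool (Poly_Mapping.keys m \<subseteq> F))"

lemma set_eval_single: "set_eval F (Poly_Mapping.single m k) = k * of_bool (Poly_Mapping.keys m \<subseteq> F)"
  by (simp add: set_eval_def)

lemma set_eval_add: "set_eval F (p + q) = set_eval F p + set_eval F q"
  unfolding set_eval_def
  by (rule setsum_keys_plus_distrib) (simp_all add: algebra_simps)

lemma set_eval_diff: "set_eval F (p - q) = set_eval F p - set_eval F q"
  using set_eval_add[of F "p - q" q] by simp

lemma set_eval_0 [simp]: "set_eval F 0 = 0"
  by (simp add: set_eval_def)

lemma set_eval_1 [simp]: "set_eval F 1 = 1"
  unfolding single_one[symmetric] set_eval_single by simp

lemma set_eval_poly_var [simp]: "set_eval F (poly_var \<alpha>) = of_bool (\<alpha> \<in> F)"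
  by (simp add: poly_var_def set_eval_single)

text \<open>Natural exponents cannot cancel, which sharpens the general inclusion
  \<open>keys_add\<close> to an equality.\<close>

lemma keys_add_nat:
  "Poly_Mapping.keys (a + b) = Poly_Mapping.keys a \<union> Poly_Mapping.keys (b :: 'a \<Rightarrow>\<^sub>0 nat)"
  by (auto simp: in_keys_iff lookup_add)

text \<open>Both sides are additive in \<open>p\<close> and in \<open>q\<close>, and polynomials
  form the free abelian group on the monomials. Two uses of \<open>frag_induction\<close> leave a
  product of two monomials, whose support is the union of theirs.\<close>

lemma set_eval_mult: "set_eval F (p * q) = set_eval F p * set_eval F q"
proof (induction p rule: frag_induction[OF subset_UNIV])
  case (2 m)
  show ?case
  proof (induction q rule: frag_induction[OF subset_UNIV])
    case (2 m')
    show ?case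
      by (auto simp: mult_single set_eval_single keys_add_nat)
  qed (simp_all add: algebra_simps set_eval_diff)
qed (simp_all add: algebra_simps set_eval_diff)

lemma set_eval_of_int [simp]: "set_eval F (of_int k) = k"
proof -
  have nat: "set_eval F (of_nat n) = int n" for n
    by (induction n) (simp_all add: set_eval_add)
  show ?thesis
    using nat[of "nat k"] nat[of "nat (- k)"] set_eval_diff[of F 0 "of_int (- k)"]
    by (cases "k \<ge> 0") simp_all
qed

lemma set_eval_sum: "set_eval F (sum f A) = (\<Sum>i\<in>A. set_eval F (f i))"
  by (induction A rule: infinite_finite_induct) (simp_all add: set_eval_add)

text \<open>In this form the kernel of the evaluation becomes available as an ideal.\<close>

lemma set_eval_hom: "ring_hom_ring (int_poly_ring V) \<Z> (set_eval F)"
  by (rule ring_hom_ringI)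
    (simp_all add: cring.axioms(1)[OF int_poly_ring_cring] int.ring_axioms set_eval_mult set_eval_add)


section \<open>The ring of a finite poset\<close>

locale finite_poset =
  fixes P :: "'a set" and leq :: "'a \<Rightarrow> 'a \<Rightarrow> bool"
  assumes finite_P: "finite P"
    and leq_refl: "\<alpha> \<in> P \<Longrightarrow> leq \<alpha> \<alpha>"
    and leq_antisym: "\<lbrakk>\<alpha> \<in> P; \<beta> \<in> P; leq \<alpha> \<beta>; leq \<beta> \<alpha>\<rbrakk> \<Longrightarrow> \<alpha> = \<beta>"
    and leq_trans: "\<lbrakk>\<alpha> \<in> P; \<beta> \<in> P; \<gamma> \<in> P; leq \<alpha> \<beta>; leq \<beta> \<gamma>\<rbrakk> \<Longrightarrow> leq \<alpha> \<gamma>"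
begin

abbreviation "R \<equiv> int_poly_ring P"
abbreviation "I \<equiv> U_ideal P leq"
abbreviation "A \<equiv> antichains P leq"
abbreviation var_prod :: "'a set \<Rightarrow> ('a \<Rightarrow>\<^sub>0 nat) \<Rightarrow>\<^sub>0 int" where
  "var_prod p \<equiv> \<Prod>\<alpha>\<in>p. poly_var \<alpha>"

sublocale R: cring R by (rule int_poly_ring_cring)

lemma U_relations_subset: "U_relations P leq \<subseteq> carrier R"
proof -
  have "poly_var \<alpha> * poly_var \<beta> - poly_var (poset_min leq \<alpha> \<beta>) \<in> carrier R"
    if "\<alpha> \<in> P" "\<beta> \<in> P" for \<alpha> \<beta>
    using R.m_closed[OF poly_var_in_carrier[OF that(1)] poly_var_in_carrier[OF that(2)]] that
    by (auto intro!: int_poly_ring_minus_closed poly_var_in_carrier simp: poset_min_def)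
  then show ?thesis
    by (auto simp: U_relations_def)
qed

sublocale I: ideal I R
  unfolding U_ideal_def by (rule R.genideal_ideal) (rule U_relations_subset)

sublocale pi: ring_hom_cring R "U_ring P leq" "(+>\<^bsub>R\<^esub>) I"
  unfolding U_ring_def by (rule I.rcos_ring_hom_cring) (rule int_poly_ring_cring)

section \<open>Calculation modulo the ideal of relations\<close>

text \<open>Congruences between polynomials replace equalities of cosets, so that the arithmetic of
  the type applies directly; cosets return in \<open>pi_combination\<close>.\<close>

definition cong :: "(('a \<Rightarrow>\<^sub>0 nat) \<Rightarrow>\<^sub>0 int) \<Rightarrow> (('a \<Rightarrow>\<^sub>0 nat) \<Rightarrow>\<^sub>0 int) \<Rightarrow> bool" (infix "\<asymp>" 50) where
  "x \<asymp> y \<longleftrightarrow> x - y \<in> I"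

lemma cong_refl: "x \<asymp> x"
  using I.zero_closed by (simp add: cong_def)

lemma cong_add: "\<lbrakk>x \<asymp> y; x' \<asymp> y'\<rbrakk> \<Longrightarrow> x + x' \<asymp> y + y'"
  using I.a_closed[of "x - y" "x' - y'"] by (simp add: cong_def algebra_simps)

lemma cong_trans [trans]: "\<lbrakk>x \<asymp> y; y \<asymp> z\<rbrakk> \<Longrightarrow> x \<asymp> z"
  using I.a_closed[of "x - y" "y - z"] by (simp add: cong_def)

lemma cong_mult: "\<lbrakk>r \<in> carrier R; x \<asymp> y\<rbrakk> \<Longrightarrow> r * x \<asymp> r * y"
  using I.I_l_closed[of "x - y" r] by (simp add: cong_def algebra_simps)

lemma of_int_closed: "of_int k \<in> carrier R"
  using R.add.int_pow_closed[OF R.one_closed, of k] int_poly_ring_add_pow[of 1 P k] R.one_closed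
  by simp

lemma poly_var_funcset: "p \<subseteq> P \<Longrightarrow> poly_var \<in> p \<rightarrow> carrier R"
  by (rule Pi_I) (rule poly_var_in_carrier, erule (1) subsetD)

lemma var_prod_closed:
  assumes "p \<subseteq> P"
  shows "var_prod p \<in> carrier R"
proof -
  note vars = poly_var_funcset[OF assms]
  show ?thesis
    using R.finprod_closed[OF vars] unfolding int_poly_ring_finprod[OF vars] .
qed

lemma var_mult_below:
  assumes "\<alpha> \<in> P" "\<beta> \<in> P" "leq \<alpha> \<beta>"
  shows "poly_var \<beta> * poly_var \<alpha> \<asymp> poly_var \<alpha>"
proof -
  have "poly_var \<alpha> * poly_var \<beta> - poly_var (poset_min leq \<alpha> \<beta>) \<in> U_relations P leq"
    using assms unfolding U_relations_def by blast
  then show ?thesis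
    using R.genideal_self[OF U_relations_subset] assms(3)
    by (auto simp: cong_def U_ideal_def poset_min_def mult.commute)
qed

text \<open>By induction on \<open>T\<close>: the variable of the common lower bound \<alpha>
  absorbs the factors of \<open>T\<close> one at a time.\<close>

lemma var_prod_above:
  assumes "finite T" "T \<subseteq> P" "\<alpha> \<in> P" "\<forall>\<beta>\<in>T. leq \<alpha> \<beta>"
  shows "var_prod T * poly_var \<alpha> \<asymp> poly_var \<alpha>"
  using assms
proof (induction T rule: finite_induct)
  case empty
  then show ?case by (simp add: cong_refl)
next
  case (insert \<beta> T)
  have "poly_var \<beta> * (var_prod T * poly_var \<alpha>) \<asymp> poly_var \<beta> * poly_var \<alpha>"
    using insert by (intro cong_mult poly_var_in_carrier) auto
  also have "poly_var \<beta> * poly_var \<alpha> \<asymp> poly_var \<alpha>"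
    using insert by (intro var_mult_below) auto
  finally show ?case
    using insert by (simp add: mult.assoc)
qed

lemma antichain_subset: "p \<in> A \<Longrightarrow> p \<subseteq> P"
  by (simp add: antichains_def)

lemma term_closed: "p \<in> A \<Longrightarrow> of_int k * var_prod p \<in> carrier R"
  using R.m_closed[OF of_int_closed var_prod_closed[OF antichain_subset], of p k] by simp

lemma finite_antichains: "finite A"
  by (rule finite_subset[of _ "Pow P"]) (auto simp: finite_P antichains_def)

lemma var_mult_antichain:
  assumes p: "p \<in> A" and \<alpha>: "\<alpha> \<in> P"
  shows "\<exists>q\<in>A. poly_var \<alpha> * var_prod p \<asymp> var_prod q"
proof -
  note pP = antichain_subset[OF p]
  have fin: "finite p" using finite_subset[OF pP finite_P] .
  show ?thesis
  proof (cases "\<exists>\<beta>\<in>p. leq \<beta> \<alpha>")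
    case True
    then obtain \<beta> where \<beta>: "\<beta> \<in> p" "leq \<beta> \<alpha>" by blast
    have split: "var_prod p = poly_var \<beta> * var_prod (p - {\<beta>})"
      using prod.remove[OF fin \<beta>(1)] .
    \<comment> \<open>The smaller variable, that of \<beta>, absorbs the new factor; the other
      factors of \<open>p\<close> are carried along.\<close>
    have "var_prod (p - {\<beta>}) * (poly_var \<alpha> * poly_var \<beta>) \<asymp> var_prod (p - {\<beta>}) * poly_var \<beta>"
      using \<beta> pP \<alpha> by (intro cong_mult var_prod_closed var_mult_below) auto
    then have "poly_var \<alpha> * var_prod p \<asymp> var_prod p"
      by (simp add: split mult_ac)
    then show ?thesis using p by blast
  next
    case False
    define T where "T = {\<beta>\<in>p. leq \<alpha> \<beta>}"
    have T: "T \<subseteq> p" "finite T" using fin by (auto simp: T_def)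
    have "var_prod (p - T) * (var_prod T * poly_var \<alpha>) \<asymp> var_prod (p - T) * poly_var \<alpha>"
      using pP T \<alpha> by (intro cong_mult var_prod_closed var_prod_above) (auto simp: T_def)
    moreover have "var_prod (p - T) * (var_prod T * poly_var \<alpha>) = poly_var \<alpha> * var_prod p"
      using prod.subset_diff[OF T(1) fin, of poly_var] by (simp add: mult_ac)
    \<comment> \<open>Reflexivity and the case assumption exclude \<alpha> from \<open>p\<close>, so
      inserting it adds a genuine new factor.\<close>
    moreover have "\<alpha> \<notin> p"
      using False leq_refl[OF \<alpha>] by blast
    then have "var_prod (p - T) * poly_var \<alpha> = var_prod (insert \<alpha> (p - T))"
      using fin by (simp add: mult_ac)
    \<comment> \<open>By the case assumption no element of \<open>p\<close> lies below \<alpha>, and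
      those above it form \<open>T\<close>.\<close>
    moreover have "insert \<alpha> (p - T) \<in> A"
      using p \<alpha> False by (auto simp: antichains_def T_def)
    ultimately show ?thesis by auto
  qed
qed

section \<open>The products over antichains span\<close>

text \<open>The sum runs over all of the finite set \<open>A\<close>, so that combinations are added
  coefficient by coefficient without matching index sets.\<close>

definition spanned :: "(('a \<Rightarrow>\<^sub>0 nat) \<Rightarrow>\<^sub>0 int) \<Rightarrow> bool" where
  "spanned x \<longleftrightarrow> (\<exists>c. x \<asymp> (\<Sum>q\<in>A. of_int (c q) * var_prod q))"

lemma spanned_cong: "\<lbrakk>x \<asymp> y; spanned y\<rbrakk> \<Longrightarrow> spanned x"
  unfolding spanned_def by (elim exE) (rule exI, rule cong_trans)

lemma spanned_add:
  assumes "spanned x" "spanned y"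
  shows "spanned (x + y)"
proof -
  from assms obtain c d where
    "x \<asymp> (\<Sum>q\<in>A. of_int (c q) * var_prod q)" "y \<asymp> (\<Sum>q\<in>A. of_int (d q) * var_prod q)"
    unfolding spanned_def by blast
  from cong_add[OF this] have "x + y \<asymp> (\<Sum>q\<in>A. of_int (c q + d q) * var_prod q)"
    by (simp add: sum.distrib algebra_simps)
  then show ?thesis
    unfolding spanned_def by (rule exI[of _ "\<lambda>q. c q + d q"])
qed

lemma spanned_scale:
  assumes "spanned x"
  shows "spanned (of_int k * x)"
proof -
  from assms obtain c where "x \<asymp> (\<Sum>q\<in>A. of_int (c q) * var_prod q)"
    unfolding spanned_def by blast
  from cong_mult[OF of_int_closed this, of k]
  have "of_int k * x \<asymp> (\<Sum>q\<in>A. of_int (k * c q) * var_prod q)"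
    by (simp add: sum_distrib_left mult.assoc)
  then show ?thesis
    unfolding spanned_def by (rule exI[of _ "\<lambda>q. k * c q"])
qed

lemma spanned_0: "spanned 0"
  unfolding spanned_def by (rule exI[of _ "\<lambda>_. 0"]) (simp add: cong_refl)

lemma spanned_sum: "(\<And>i. i \<in> J \<Longrightarrow> spanned (f i)) \<Longrightarrow> spanned (sum f J)"
  by (induction J rule: infinite_finite_induct) (auto intro: spanned_0 spanned_add)

lemma spanned_var_prod: "p \<in> A \<Longrightarrow> spanned (var_prod p)"
proof -
  assume "p \<in> A"
  then have "(\<Sum>q\<in>A. of_int (of_bool (q = p)) * var_prod q) = var_prod p"
    using finite_antichains by (subst sum.remove[of A p]) (auto intro!: sum.neutral)
  then show ?thesis
    unfolding spanned_def by (intro exI[of _ "\<lambda>q. of_bool (q = p)"]) (simp only: cong_refl)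
qed

text \<open>Different \<open>q\<close> may be sent to the same antichain by
  \<open>var_mult_antichain\<close>, so no new coefficients are written down: the closure properties
  of \<open>spanned\<close> collect the terms.\<close>

lemma spanned_mult_var:
  assumes x: "spanned x" and \<alpha>: "\<alpha> \<in> P"
  shows "spanned (poly_var \<alpha> * x)"
proof -
  from x obtain c where "x \<asymp> (\<Sum>q\<in>A. of_int (c q) * var_prod q)"
    unfolding spanned_def by blast
  from cong_mult[OF poly_var_in_carrier[OF \<alpha>] this]
  have "poly_var \<alpha> * x \<asymp> (\<Sum>q\<in>A. of_int (c q) * (poly_var \<alpha> * var_prod q))"
    by (simp only: sum_distrib_left mult.left_commute[of "poly_var \<alpha>"])
  moreover have "spanned (poly_var \<alpha> * var_prod q)" if "q \<in> A" for q
  proof -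
    from var_mult_antichain[OF that \<alpha>] obtain r
      where "r \<in> A" "poly_var \<alpha> * var_prod q \<asymp> var_prod r" ..
    then show ?thesis
      using spanned_cong[OF _ spanned_var_prod[of r]] by simp
  qed
  ultimately show ?thesis
    by (rule spanned_cong[OF _ spanned_sum[OF spanned_scale]])
qed

text \<open>A monomial is built from 1 by multiplying with one variable at a time. The outer
  induction adds a variable to the support, the inner one raises its exponent.\<close>

lemma spanned_monomial:
  "Poly_Mapping.keys m \<subseteq> P \<Longrightarrow> spanned (Poly_Mapping.single m 1)"
proof (induction m rule: update_induct)
  case const
  have "{} \<in> A" by (simp add: antichains_def)
  from spanned_var_prod[OF this] show ?case by simp
next
  case (update f a b)
  have a: "a \<in> P" and f: "Poly_Mapping.keys f \<subseteq> P"
    using update.prems update.hyps by (auto simp: keys_update)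
  have eq: "Poly_Mapping.update a b f = Poly_Mapping.single a b + f"
    using update.hyps(1)
    by (intro poly_mapping_eqI) (auto simp: lookup_update lookup_add lookup_single in_keys_iff when_def)
  \<comment> \<open>Here \<open>b\<close> is rebound: the exponent supplied by
    \<open>update_induct\<close> is nonzero, whereas this induction starts at 0.\<close>
  have "spanned (Poly_Mapping.single (Poly_Mapping.single a b + f) 1)" for b :: nat
  proof (induction b)
    case 0
    then show ?case using update.IH f by simp
  next
    case (Suc b)
    have "Poly_Mapping.single a (Suc b) = Poly_Mapping.single a 1 + Poly_Mapping.single a b"
      using single_add[of a 1 b] by simp
    then have "Poly_Mapping.single (Poly_Mapping.single a (Suc b) + f) 1
        = poly_var a * Poly_Mapping.single (Poly_Mapping.single a b + f) 1"
      by (simp only: poly_var_def mult_single add.assoc mult_1)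
    then show ?case
      using spanned_mult_var[OF Suc a] by simp
  qed
  then show ?case by (simp add: eq)
qed

text \<open>Polynomials with variables in \<open>P\<close> form the free abelian group on the
  monomials over \<open>P\<close>, so \<open>frag_induction\<close> reduces the claim to
  \<open>spanned_monomial\<close>.\<close>

lemma spanned_carrier:
  assumes "x \<in> carrier R"
  shows "spanned x"
proof -
  have "Poly_Mapping.keys x \<subseteq> {m. Poly_Mapping.keys m \<subseteq> P}"
    using assms by (auto simp: int_poly_ring_def)
  then show ?thesis
  proof (induction x rule: frag_induction)
    case (one m)
    then show ?case using spanned_monomial by simp
  next
    case (diff a b)
    then show ?case
      using spanned_add[OF diff(1) spanned_scale[OF diff(2), of "- 1"]] by simp
  qed (rule spanned_0)
qed

section \<open>Passage to the quotient ring\<close>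

text \<open>The quotient map is a ring homomorphism, hence commutes with finite products, integer
  multiples and finite sums. This translates between polynomials modulo \<open>I\<close> and the
  combinations in \<open>Z_basis\<close>.\<close>

lemma pi_combination:
  assumes "J \<subseteq> A"
  shows "I +>\<^bsub>R\<^esub> (\<Sum>q\<in>J. of_int (c q) * var_prod q)
    = (\<Oplus>\<^bsub>U_ring P leq\<^esub>q\<in>J. [(c q :: int)] \<cdot>\<^bsub>U_ring P leq\<^esub> U_prod P leq q)"
proof -
  have closed: "var_prod q \<in> carrier R" if "q \<in> J" for q
    using var_prod_closed[OF antichain_subset[OF subsetD[OF assms that]]] .
  have prod: "I +>\<^bsub>R\<^esub> var_prod q = U_prod P leq q" if "q \<in> J" for q
  proof -
    have q: "poly_var \<in> q \<rightarrow> carrier R"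
      by (rule poly_var_funcset[OF antichain_subset[OF subsetD[OF assms that]]])
    have "U_prod P leq q = (\<Otimes>\<^bsub>U_ring P leq\<^esub>\<alpha>\<in>q. ((+>\<^bsub>R\<^esub>) I \<circ> poly_var) \<alpha>)"
      by (simp add: U_prod_def U_gen_def comp_def)
    also have "\<dots> = I +>\<^bsub>R\<^esub> finprod R poly_var q"
      using pi.hom_finprod[OF q] by (simp add: comp_def)
    finally show ?thesis
      using int_poly_ring_finprod[OF q] by simp
  qed
  have scale: "I +>\<^bsub>R\<^esub> (of_int k * var_prod q) = [k] \<cdot>\<^bsub>U_ring P leq\<^esub> U_prod P leq q"
    if "q \<in> J" for q k
  proof -
    \<comment> \<open>An integer multiple is a power in the additive group, so the fact about group
      homomorphisms and integer powers applies.\<close>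
    have "I +>\<^bsub>R\<^esub> ([k] \<cdot>\<^bsub>R\<^esub> var_prod q) = [k] \<cdot>\<^bsub>U_ring P leq\<^esub> (I +>\<^bsub>R\<^esub> var_prod q)"
      unfolding add_pow_def
      using group_hom.hom_int_pow[OF pi.ring.a_group_hom, of "var_prod q" k] closed[OF that] by simp
    then show ?thesis
      using int_poly_ring_add_pow[OF closed[OF that]] prod[OF that] by simp
  qed
  have terms: "(\<lambda>q. of_int (c q) * var_prod q) \<in> J \<rightarrow> carrier R"
    by (rule Pi_I) (rule term_closed[OF subsetD[OF assms]])
  have "I +>\<^bsub>R\<^esub> (\<Sum>q\<in>J. of_int (c q) * var_prod q)
      = (\<Oplus>\<^bsub>U_ring P leq\<^esub>q\<in>J. I +>\<^bsub>R\<^esub> (of_int (c q) * var_prod q))"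
    using pi.hom_finsum[OF terms] int_poly_ring_finsum[OF terms] by (simp add: comp_def)
  also have "\<dots> = (\<Oplus>\<^bsub>U_ring P leq\<^esub>q\<in>J. [(c q :: int)] \<cdot>\<^bsub>U_ring P leq\<^esub> U_prod P leq q)"
  proof (rule pi.S.add.finprod_cong')
    have "[c q] \<cdot>\<^bsub>U_ring P leq\<^esub> U_prod P leq q \<in> carrier (U_ring P leq)" if "q \<in> J" for q
      unfolding scale[OF that, symmetric] by (rule pi.hom_closed[OF funcset_mem[OF terms that]])
    then show "(\<lambda>q. [c q] \<cdot>\<^bsub>U_ring P leq\<^esub> U_prod P leq q) \<in> J \<rightarrow> carrier (U_ring P leq)"
      by blast
  qed (simp_all add: scale)
  finally show ?thesis .
qed

lemma U_prod_closed:
  assumes "p \<in> A"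
  shows "U_prod P leq p \<in> carrier (U_ring P leq)"
  unfolding U_prod_def U_gen_def
proof (intro pi.S.finprod_closed Pi_I)
  fix \<alpha> assume "\<alpha> \<in> p"
  then have "\<alpha> \<in> P" using antichain_subset[OF assms] by blast
  then show "I +>\<^bsub>R\<^esub> poly_var \<alpha> \<in> carrier (U_ring P leq)"
    by (rule pi.hom_closed[OF poly_var_in_carrier])
qed

section \<open>Linear independence by evaluation at upper sets\<close>

text \<open>If \<alpha> \<le> \<beta> and \<open>F\<close> is an upper set, \<alpha> \<in> F forces
  \<beta> \<in> F, so the values of the two variables multiply to that of \<alpha>. Thus the kernel
  of the evaluation is an ideal containing all relations, hence the ideal they generate.\<close>

lemma set_eval_ideal:
  assumes up: "\<And>\<alpha> \<beta>. \<lbrakk>\<alpha> \<in> P; \<beta> \<in> P; leq \<alpha> \<beta>; \<alpha> \<in> F\<rbrakk> \<Longrightarrow> \<beta> \<in> F"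
    and x: "x \<in> I"
  shows "set_eval F x = 0"
proof -
  have kernel: "a_kernel R \<Z> (set_eval F) = {y \<in> carrier R. set_eval F y = 0}"
    unfolding a_kernel_def' by simp
  have "U_relations P leq \<subseteq> {y \<in> carrier R. set_eval F y = 0}"
  proof
    fix y assume y: "y \<in> U_relations P leq"
    then have "set_eval F y = 0"
      using up unfolding U_relations_def
      by (auto simp: set_eval_diff set_eval_mult poset_min_def)
    then show "y \<in> {y \<in> carrier R. set_eval F y = 0}"
      using subsetD[OF U_relations_subset y] by blast
  qed
  then have "I \<subseteq> {y \<in> carrier R. set_eval F y = 0}"
    unfolding U_ideal_def
    by (rule R.genideal_minimal[OF ring_hom_ring.kernel_is_ideal[OF set_eval_hom, of P F, unfolded kernel]])
  then show ?thesis
    using x by blast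
qed

definition up_closure :: "'a set \<Rightarrow> 'a set" where
  "up_closure p = {\<beta>\<in>P. \<exists>\<alpha>\<in>p. leq \<alpha> \<beta>}"

lemma subset_up_closure: "p \<subseteq> P \<Longrightarrow> p \<subseteq> up_closure p"
  by (auto simp: up_closure_def intro: leq_refl)

lemma up_closure_upward:
  assumes "p \<subseteq> P" "\<alpha> \<in> P" "\<beta> \<in> P" "leq \<alpha> \<beta>" "\<alpha> \<in> up_closure p"
  shows "\<beta> \<in> up_closure p"
proof -
  obtain \<gamma> where "\<gamma> \<in> p" "leq \<gamma> \<alpha>"
    using assms(5) by (auto simp: up_closure_def)
  moreover have "leq \<gamma> \<beta>"
    using calculation assms by (intro leq_trans[of \<gamma> \<alpha> \<beta>]) auto
  ultimately show ?thesis
    using assms(3) by (auto simp: up_closure_def)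
qed

lemma up_closure_mono:
  assumes "p \<subseteq> P" "q \<subseteq> up_closure p"
  shows "up_closure q \<subseteq> up_closure p"
proof
  fix \<beta> assume "\<beta> \<in> up_closure q"
  then obtain \<alpha> where "\<alpha> \<in> q" "leq \<alpha> \<beta>" "\<beta> \<in> P"
    by (auto simp: up_closure_def)
  with assms show "\<beta> \<in> up_closure p"
    by (intro up_closure_upward[of p \<alpha> \<beta>]) (auto simp: up_closure_def)
qed

text \<open>An antichain consists of the minimal elements of its up-closure. Concretely, each
  \<alpha> in \<open>p\<close> lies above some \<beta> in \<open>q\<close>, which lies above some
  \<gamma> in \<open>p\<close>; then \<gamma> = \<alpha> since \<open>p\<close> is an antichain, and
  \<beta> is squeezed between them. Exchanging \<open>p\<close> and \<open>q\<close> gives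
  equality.\<close>

lemma antichain_subset_of_up_closure_eq:
  assumes p: "p \<in> A" and q: "q \<in> A" and eq: "up_closure p = up_closure q"
  shows "p \<subseteq> q"
proof
  fix \<alpha> assume \<alpha>: "\<alpha> \<in> p"
  note sub = antichain_subset[OF p] antichain_subset[OF q]
  obtain \<beta> where \<beta>: "\<beta> \<in> q" "leq \<beta> \<alpha>"
    using \<alpha> sub(1) subset_up_closure[of p] eq unfolding up_closure_def by blast
  obtain \<gamma> where \<gamma>: "\<gamma> \<in> p" "leq \<gamma> \<beta>"
    using \<beta>(1) sub(2) subset_up_closure[of q] eq[symmetric] unfolding up_closure_def by blast
  have "leq \<gamma> \<alpha>"
    using leq_trans[of \<gamma> \<beta> \<alpha>] \<alpha> \<beta> \<gamma> sub by blast
  then have "\<gamma> = \<alpha>"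
    using \<alpha> \<gamma> p by (auto simp: antichains_def)
  then have "\<alpha> = \<beta>"
    using leq_antisym[of \<alpha> \<beta>] \<alpha> \<beta> \<gamma> sub by blast
  then show "\<alpha> \<in> q" using \<beta> by simp
qed

lemma set_eval_var_prod:
  assumes "finite q"
  shows "set_eval F (var_prod q) = of_bool (q \<subseteq> F)"
  using assms by (induction q) (auto simp: set_eval_mult)

lemma independent_mod_ideal:
  assumes J: "finite J" "J \<subseteq> A" and x: "(\<Sum>q\<in>J. of_int (c q) * var_prod q) \<in> I"
  shows "\<forall>q\<in>J. c q = 0"
proof (rule ccontr)
  define K where "K = {q\<in>J. c q \<noteq> 0}"
  assume "\<not> (\<forall>q\<in>J. c q = 0)"
  then have "up_closure ` K \<noteq> {}" "finite (up_closure ` K)"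
    using J by (auto simp: K_def)
  then obtain F where F: "F \<in> up_closure ` K" "\<And>G. G \<in> up_closure ` K \<Longrightarrow> G \<subseteq> F \<Longrightarrow> F = G"
    using finite_has_minimal[of "up_closure ` K"] by metis
  then obtain p where p: "p \<in> K" "F = up_closure p" by blast
  have pA: "p \<in> A" and pP: "p \<subseteq> P" and pJ: "p \<in> J"
    using p J antichain_subset by (auto simp: K_def)
  \<comment> \<open>If \<open>q\<close> lies in \<open>F\<close>, so does its up-closure. For
    \<open>q\<close> in \<open>K\<close>, minimality of \<open>F\<close> then makes the up-closures
    of \<open>q\<close> and \<open>p\<close> equal, whence \<open>q = p\<close>; outside
    \<open>K\<close> the coefficient vanishes.\<close>
  have others: "c q * of_bool (q \<subseteq> F) = (if q = p then c p else 0)" if q: "q \<in> J" for q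
  proof (cases "q \<in> K \<and> q \<subseteq> F")
    case True
    then have "up_closure q = up_closure p"
      using F(2)[of "up_closure q"] up_closure_mono[OF pP, of q] p by auto
    then have "q = p"
      using antichain_subset_of_up_closure_eq pA q J by (metis subset_antisym subsetD)
    then show ?thesis using True by simp
  next
    case False
    then show ?thesis
      using p q subset_up_closure[OF pP] by (auto simp: K_def)
  qed
  have "0 = set_eval F (\<Sum>q\<in>J. of_int (c q) * var_prod q)"
    using set_eval_ideal[OF up_closure_upward[OF pP] x] p by simp
  also have "\<dots> = (\<Sum>q\<in>J. c q * of_bool (q \<subseteq> F))"
    unfolding set_eval_sum
  proof (rule sum.cong)
    fix q assume "q \<in> J"
    then have "finite q"
      using J antichain_subset finite_subset finite_P by blast
    then show "set_eval F (of_int (c q) * var_prod q) = c q * of_bool (q \<subseteq> F)"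
      by (simp add: set_eval_mult set_eval_var_prod)
  qed simp
  also have "\<dots> = (\<Sum>q\<in>J. if q = p then c p else 0)"
    by (rule sum.cong) (use others in auto)
  also have "\<dots> = c p"
    using J pJ by simp
  finally show False
    using p by (simp add: K_def)
qed

theorem Z_basis_antichains: "Z_basis (U_ring P leq) A (U_prod P leq)"
  unfolding Z_basis_def
proof (intro conjI ballI allI impI)
  show "U_prod P leq \<in> A \<rightarrow> carrier (U_ring P leq)"
    using U_prod_closed by blast
next
  fix X assume "X \<in> carrier (U_ring P leq)"
  then obtain x where x: "x \<in> carrier R" "X = I +>\<^bsub>R\<^esub> x"
    by (auto simp: U_ring_def FactRing_def A_RCOSETS_def')
  obtain c where c: "x \<asymp> (\<Sum>q\<in>A. of_int (c q) * var_prod q)"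
    using spanned_carrier[OF x(1)] unfolding spanned_def by blast
  let ?s = "\<Sum>q\<in>A. of_int (c q) * var_prod q"
  \<comment> \<open>Membership follows from writing \<open>?s\<close> as
    \<open>x - (x - ?s)\<close>, where the subtracted element lies in \<open>I\<close> and so in the
    carrier.\<close>
  have s: "?s \<in> carrier R"
    using int_poly_ring_minus_closed[OF x(1) I.a_Hcarr, of "x - ?s"] c by (simp add: cong_def)
  have "X = I +>\<^bsub>R\<^esub> ?s"
    using R.quotient_eq_iff_same_a_r_cos[OF I.is_ideal x(1) s] c x s
    by (simp add: cong_def a_minus_def int_poly_ring_a_inv)
  then have "X = (\<Oplus>\<^bsub>U_ring P leq\<^esub>q\<in>A. [c q] \<cdot>\<^bsub>U_ring P leq\<^esub> U_prod P leq q)"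
    using pi_combination[of A c] by simp
  then show "\<exists>J c. finite J \<and> J \<subseteq> A \<and>
      X = (\<Oplus>\<^bsub>U_ring P leq\<^esub>q\<in>J. [(c q :: int)] \<cdot>\<^bsub>U_ring P leq\<^esub> U_prod P leq q)"
    using finite_antichains by blast
next
  fix J q and c :: "'a set \<Rightarrow> int"
  assume q: "q \<in> J" and *: "finite J \<and> J \<subseteq> A \<and>
    (\<Oplus>\<^bsub>U_ring P leq\<^esub>q\<in>J. [c q] \<cdot>\<^bsub>U_ring P leq\<^esub> U_prod P leq q) = \<zero>\<^bsub>U_ring P leq\<^esub>"
  let ?s = "\<Sum>q\<in>J. of_int (c q) * var_prod q"
  have terms: "(\<lambda>q. of_int (c q) * var_prod q) \<in> J \<rightarrow> carrier R"
    using * by (intro Pi_I term_closed) blast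
  have s: "?s \<in> carrier R"
    using R.finsum_closed[OF terms] unfolding int_poly_ring_finsum[OF terms] .
  \<comment> \<open>The zero of the quotient ring is \<open>I\<close> itself.\<close>
  have "I +>\<^bsub>R\<^esub> ?s = I"
    using * pi_combination[of J c] by (simp add: U_ring_def FactRing_def)
  then have "?s \<in> I"
    using I.rcos_const_imp_mem s by blast
  then show "c q = 0"
    using independent_mod_ideal[of J c] * q by blast
qed

end


section \<open>The poset of positive roots\<close>

text \<open>\<open>representation\<close> is zero outside the span, so
  \<open>span \<Delta> = UNIV\<close> ensures that coefficients are additive and determine the
  vector. Antisymmetry holds because a coefficient and its negative are both nonnegative,
  transitivity because the coefficients of the differences add up.\<close>

lemma finite_poset_positive_roots:
  fixes \<Phi> \<Delta> :: "'a::euclidean_space set"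
  assumes "finite \<Phi>" and ind: "independent \<Delta>" and span: "span \<Delta> = UNIV"
  shows "finite_poset (positive_roots \<Phi> \<Delta>) (root_le \<Delta>)"
proof
  show "finite (positive_roots \<Phi> \<Delta>)"
    using assms(1) by (simp add: positive_roots_def)
next
  fix \<alpha> show "root_le \<Delta> \<alpha> \<alpha>"
    by (simp add: root_le_def representation_zero)
next
  fix \<alpha> \<beta> assume "root_le \<Delta> \<alpha> \<beta>" "root_le \<Delta> \<beta> \<alpha>"
  \<comment> \<open>The order constrains the coefficients at \<delta> in \<Delta>; at all other
    \<delta> they vanish by \<open>representation_ne_zero\<close>.\<close>
  then have "representation \<Delta> (\<beta> - \<alpha>) \<delta> = 0" for \<delta>
    using representation_ne_zero[of \<Delta> "\<beta> - \<alpha>" \<delta>]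
      representation_neg[OF ind, of "\<beta> - \<alpha>"] span
    by (fastforce simp: root_le_def)
  then have "\<beta> - \<alpha> = 0"
    using sum_nonzero_representation_eq[OF ind, of "\<beta> - \<alpha>"] span by simp
  then show "\<alpha> = \<beta>" by simp
next
  fix \<alpha> \<beta> \<gamma> assume "root_le \<Delta> \<alpha> \<beta>" "root_le \<Delta> \<beta> \<gamma>"
  then show "root_le \<Delta> \<alpha> \<gamma>"
    using representation_add[OF ind, of "\<beta> - \<alpha>" "\<gamma> - \<beta>"] span
    by (auto simp: root_le_def)
qed

theorem proposition5p2:
  fixes X :: dynkin and \<Phi> \<Delta> :: "'a::euclidean_space set"
  assumes "valid_dynkin X"
    and "root_system \<Phi>" and "crystallographic \<Phi>" and "reduced_roots \<Phi>" and "irreducible_roots \<Phi>"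
    and "simple_roots \<Phi> \<Delta>" and "of_dynkin_type \<Delta> X"
  shows "Z_basis (U_ring (positive_roots \<Phi> \<Delta>) (root_le \<Delta>))
           (antichains (positive_roots \<Phi> \<Delta>) (root_le \<Delta>))
           (U_prod (positive_roots \<Phi> \<Delta>) (root_le \<Delta>))"
proof -
  interpret finite_poset "positive_roots \<Phi> \<Delta>" "root_le \<Delta>"
    using assms(2,6) unfolding root_system_def simple_roots_def
    by (elim conjE) (rule finite_poset_positive_roots)
  show ?thesis by (rule Z_basis_antichains)
qed

end
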